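(* Let $k \ge 3$ and let $G$ be a $(k+1)$-critical graph with minimum degree $\delta(G)=k$. Then there exists an injective map $f:\mathcal{C}_{\le k}(K_{k+1}) \to \mathcal{C}(G)$ such that for every $C\in \mathcal{C}_{\le k}(K_{k+1})$, $|V(f(C))| \equiv 0 \pmod{|V(C)|}$.
   Context: A graph is $(k+1)$-critical if its chromatic number is $k+1$ but every proper subgraph has chromatic number at most $k$. For a graph $H$, $\mathcal{C}(H)$ denotes the set of all cycles (as subgraphs) of $H$, and $\mathcal{C}_{\le i}(H)$ the set of cycles of $H$ of length at most $i$. $K_{k+1}$ is the complete graph on $k+1$ vertices. *)

theory Defs
  imports Main "HOL-Number_Theory.Cong"
begin

text \<open>Finite simple graphs: a pair of a finite vertex set and a set of edges,
  each edge being a two-element set of vertices.\<close>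

type_synonym 'a graph = "'a set \<times> 'a set set"

abbreviation verts :: "'a graph \<Rightarrow> 'a set" where
  "verts G \<equiv> fst G"

abbreviation edges :: "'a graph \<Rightarrow> 'a set set" where
  "edges G \<equiv> snd G"

definition simple_graph :: "'a graph \<Rightarrow> bool" where
  "simple_graph G \<longleftrightarrow> finite (verts G) \<and> (\<forall>e\<in>edges G. e \<subseteq> verts G \<and> card e = 2)"

definition subgraph :: "'a graph \<Rightarrow> 'a graph \<Rightarrow> bool" where
  "subgraph H G \<longleftrightarrow> simple_graph H \<and> verts H \<subseteq> verts G \<and> edges H \<subseteq> edges G"

definition proper_subgraph :: "'a graph \<Rightarrow> 'a graph \<Rightarrow> bool" where
  "proper_subgraph H G \<longleftrightarrow> subgraph H G \<and> H \<noteq> G"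

definition degree :: "'a graph \<Rightarrow> 'a \<Rightarrow> nat" where
  "degree G v = card {u \<in> verts G. {v, u} \<in> edges G}"

text \<open>Only meaningful for graphs with at least one vertex.\<close>

definition min_degree :: "'a graph \<Rightarrow> nat" where
  "min_degree G = Min (degree G ` verts G)"

definition proper_coloring :: "'a graph \<Rightarrow> nat \<Rightarrow> ('a \<Rightarrow> nat) \<Rightarrow> bool" where
  "proper_coloring G n c \<longleftrightarrow>
     (\<forall>v\<in>verts G. c v < n) \<and> (\<forall>u v. {u, v} \<in> edges G \<longrightarrow> c u \<noteq> c v)"

text \<open>The set below is nonempty for every simple graph in the sense above, by finiteness.\<close>

definition chromatic_number :: "'a graph \<Rightarrow> nat" where
  "chromatic_number G = (LEAST n. \<exists>c. proper_coloring G n c)"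

text \<open>\<open>critical m G\<close> with \<open>m = k + 1\<close>: a proper subgraph has chromatic number at most \<open>k\<close>,
  that is, less than \<open>m\<close>.\<close>

definition critical :: "nat \<Rightarrow> 'a graph \<Rightarrow> bool" where
  "critical m G \<longleftrightarrow> simple_graph G \<and> chromatic_number G = m \<and>
     (\<forall>H. proper_subgraph H G \<longrightarrow> chromatic_number H < m)"

text \<open>Cycles are taken as subgraphs, so neither a starting point nor an orientation is recorded;
  the list below is just one way of traversing the cycle.\<close>

definition is_cycle :: "'a graph \<Rightarrow> bool" where
  "is_cycle C \<longleftrightarrow> (\<exists>vs. distinct vs \<and> length vs \<ge> 3 \<and> verts C = set vs \<and>
     edges C = {{vs ! i, vs ! (Suc i mod length vs)} | i. i < length vs})"

definition cycles :: "'a graph \<Rightarrow> 'a graph set" where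
  "cycles G = {C. subgraph C G \<and> is_cycle C}"

text \<open>The length of a cycle is its number of edges.\<close>

definition cycles_le :: "nat \<Rightarrow> 'a graph \<Rightarrow> 'a graph set" where
  "cycles_le i G = {C \<in> cycles G. card (edges C) \<le> i}"

definition complete_graph :: "nat \<Rightarrow> nat graph" where
  "complete_graph n = ({..<n}, {e. e \<subseteq> {..<n} \<and> card e = 2})"

end

theory Submission
  imports Defs
begin

text \<open>Let \<open>v\<close> be a vertex of degree \<open>k\<close> and \<open>c\<close> a \<open>k\<close>-coloring of \<open>G - v\<close>. As \<open>G\<close> is not
  \<open>k\<close>-colorable, every \<open>k\<close>-coloring of \<open>G - v\<close> is bijective on the neighbors of \<open>v\<close>. For a
  cyclic permutation \<open>p\<close> of some of the colors, direct an edge from \<open>u\<close> to \<open>w\<close> if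
  \<open>c w = p (c u)\<close>. Applying \<open>p\<close> to the colors of all vertices reachable from a neighbor \<open>x\<close> of
  \<open>v\<close> gives another proper coloring, so the neighbor colored \<open>p (c x)\<close> must be reachable from
  \<open>x\<close>. Hence the neighbors with colors in the support of \<open>p\<close> reach each other, and there is a
  directed cycle, whose length is divisible by the length of \<open>p\<close>.

  The vertices \<open>0, \<dots>, k - 1\<close> of the complete graph are the colors and \<open>k\<close> stands for \<open>v\<close>. A cycle
  \<open>C\<close> avoiding \<open>k\<close> is itself a cyclic order of colors. If \<open>C\<close> contains \<open>k\<close>, some color \<open>a\<close> is not
  on \<open>C\<close>; replace \<open>k\<close> by \<open>a\<close>, color \<open>v\<close> with \<open>a\<close>, and take a directed cycle through \<open>v\<close>. In
  either case \<open>C\<close> can be recovered from the cycle found in \<open>G\<close>.\<close>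

section \<open>Recoloring along directed edges\<close>

text \<open>An edge from \<open>u\<close> in \<open>R\<close> to \<open>w\<close> outside
  \<open>R\<close> could only become monochromatic if \<open>c w = p (c u)\<close>, which puts
  \<open>w\<close> into \<open>R\<close>. Inside \<open>R\<close>, injectivity of \<open>p\<close>
  keeps colors apart.\<close>

lemma shift_coloring:
  assumes H: "simple_graph H" and c: "proper_coloring H n c"
    and inj: "inj_on p {..<n}" and into: "p ` {..<n} \<subseteq> {..<n}"
    and closed: "\<And>u w. u \<in> R \<Longrightarrow> {u, w} \<in> edges H \<Longrightarrow> c w = p (c u) \<Longrightarrow> w \<in> R"
  shows "proper_coloring H n (\<lambda>u. if u \<in> R then p (c u) else c u)"
  unfolding proper_coloring_def
proof (intro conjI allI impI ballI)
  fix v assume "v \<in> verts H"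
  then show "(if v \<in> R then p (c v) else c v) < n"
    using c into by (auto simp: proper_coloring_def)
next
  fix u w assume e: "{u, w} \<in> edges H"
  then have e': "{w, u} \<in> edges H" by (simp add: insert_commute)
  have "u \<in> verts H" "w \<in> verts H" using H e by (auto simp: simple_graph_def)
  then have "c u < n" "c w < n" "c u \<noteq> c w" using c e by (auto simp: proper_coloring_def)
  then show "(if u \<in> R then p (c u) else c u) \<noteq> (if w \<in> R then p (c w) else c w)"
    using closed[OF _ e] closed[OF _ e'] inj
    by (cases "u \<in> R"; cases "w \<in> R") (auto simp: inj_on_eq_iff)
qed

text \<open>For one application of \<open>p\<close>: were \<open>y\<close> not reachable, shifting
  the colors on everything reachable from \<open>x\<close> would give \<open>x\<close> the color of
  \<open>y\<close>, against injectivity on \<open>N\<close>. Iterates are chained through the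
  vertices of \<open>N\<close> that carry the intermediate colors.\<close>

lemma reachable_iterate:
  assumes H: "simple_graph H" and c: "proper_coloring H n c"
    and inj: "inj_on p {..<n}" and into: "p ` {..<n} \<subseteq> {..<n}"
    and N: "N \<subseteq> verts H"
    and bij: "\<And>d. proper_coloring H n d \<Longrightarrow> bij_betw d N {..<n}"
    and "x \<in> N" "y \<in> N" "c y = (p ^^ j) (c x)"
  shows "(x, y) \<in> {(u, w). {u, w} \<in> edges H \<and> c w = p (c u)}\<^sup>*" (is "_ \<in> ?D\<^sup>*")
proof -
  have step: "(x, y) \<in> ?D\<^sup>*" if xy: "x \<in> N" "y \<in> N" "c y = p (c x)" for x y
  proof (rule ccontr)
    let ?R = "{u. (x, u) \<in> ?D\<^sup>*}"
    let ?d = "\<lambda>u. if u \<in> ?R then p (c u) else c u"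
    assume "(x, y) \<notin> ?D\<^sup>*"
    then have "?d y = c y" "y \<noteq> x" by auto
    moreover have "?d x = p (c x)" by simp
    moreover have "proper_coloring H n ?d"
    proof (rule shift_coloring[OF H c inj into])
      fix u w assume "u \<in> ?R" "{u, w} \<in> edges H" "c w = p (c u)"
      then show "w \<in> ?R" by (auto intro: rtrancl_into_rtrancl)
    qed
    then have "inj_on ?d N" by (rule bij_betw_imp_inj_on[OF bij])
    moreover have "?d x = ?d y" using calculation(1,3) xy(3) by simp
    ultimately show False using xy(1,2) by (blast dest: inj_onD)
  qed
  show ?thesis using \<open>y \<in> N\<close> \<open>c y = (p ^^ j) (c x)\<close>
  proof (induction j arbitrary: y)
    case 0
    then have "y = x"
      using \<open>x \<in> N\<close> bij[OF c] by (auto dest: bij_betw_imp_inj_on inj_onD)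
    then show ?case by simp
  next
    case (Suc j)
    have "c x < n" using \<open>x \<in> N\<close> bij[OF c] by (auto dest: bij_betwE)
    then have "(p ^^ j) (c x) < n" using into by (induction j) auto
    then obtain z where z: "z \<in> N" "c z = (p ^^ j) (c x)"
      using bij_betw_imp_surj_on[OF bij[OF c]] by (metis imageE lessThan_iff)
    then have "(x, z) \<in> ?D\<^sup>*" using Suc.IH by blast
    also have "(z, y) \<in> ?D\<^sup>*" using step[OF z(1)] Suc.prems z(2) by simp
    finally show ?case .
  qed
qed

section \<open>From closed walks to directed cycles\<close>

text \<open>A shortest closed walk of positive length through \<open>x\<close> repeats no vertex.
  Lengths 1 and 2 are still possible here.\<close>

lemma directed_cycle_through:
  assumes "(x, x) \<in> r\<^sup>+"
  obtains vs where "distinct vs" "vs \<noteq> []" "vs ! 0 = x"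
    "\<And>i. i < length vs \<Longrightarrow> (vs ! i, vs ! (Suc i mod length vs)) \<in> r"
proof -
  define P where "P n \<longleftrightarrow> n > 0 \<and> (x, x) \<in> r ^^ n" for n
  define n where "n = (LEAST n. P n)"
  obtain n0 where "P n0" using assms by (auto simp: trancl_power P_def)
  then have "P n" and least: "\<And>m. P m \<Longrightarrow> n \<le> m" by (auto simp: n_def intro: LeastI Least_le)
  then have n: "n > 0" "(x, x) \<in> r ^^ n" by (auto simp: P_def)
  then obtain f where f: "f 0 = x" "f n = x" "\<And>i. i < n \<Longrightarrow> (f i, f (Suc i)) \<in> r"
    by (auto simp: relpow_fun_conv)
  have walk: "(f i, f (i + d)) \<in> r ^^ d" if "i + d \<le> n" for i d
    using that
  proof (induction d)
    case (Suc d)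
    then show ?case using relpow_Suc_I[of "f i" "f (i + d)" d r] f(3)[of "i + d"] by simp
  qed simp
  have neq: "f i \<noteq> f j" if "i < j" "j < n" for i j
  proof
    assume eq: "f i = f j"
    have "(x, f i) \<in> r ^^ i" using walk[of 0 i] that f by simp
    moreover have "(f i, x) \<in> r ^^ (n - j)" using walk[of j "n - j"] that f eq by simp
    ultimately have "(x, x) \<in> r ^^ (i + (n - j))" by (auto simp: relpow_add)
    \<comment> \<open>Cutting out the part from \<open>i\<close> to \<open>j\<close> leaves a
      shorter closed walk through \<open>x\<close>, nonempty because \<open>j < n\<close>.\<close>
    then have "P (i + (n - j))" using that by (simp add: P_def)
    from least[OF this] that show False by simp
  qed
  show ?thesis
  proof
    show "distinct (map f [0..<n])"
      using neq by (auto simp: distinct_map intro!: linorder_inj_onI')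
    show "map f [0..<n] \<noteq> []" "map f [0..<n] ! 0 = x" using n f by auto
    fix i assume i: "i < length (map f [0..<n])"
    show "(map f [0..<n] ! i, map f [0..<n] ! (Suc i mod length (map f [0..<n]))) \<in> r"
    proof (cases "Suc i = n")
      case True
      then show ?thesis using f(3)[of i] f(1,2) n by simp
    next
      case False
      then show ?thesis using f(3)[of i] i by simp
    qed
  qed
qed

section \<open>Cycles given by vertex lists, and cyclic shifts\<close>

definition cycle_graph :: "'a list \<Rightarrow> 'a graph" where
  "cycle_graph vs = (set vs, {{vs ! i, vs ! (Suc i mod length vs)} | i. i < length vs})"

lemma is_cycle_iff: "is_cycle C \<longleftrightarrow> (\<exists>vs. distinct vs \<and> length vs \<ge> 3 \<and> C = cycle_graph vs)"
  by (simp add: is_cycle_def cycle_graph_def prod_eq_iff)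

text \<open>Adding \<open>j\<close> modulo the length permutes the indices. This allows a cycle
  through the vertex \<open>k\<close> to be listed starting at \<open>k\<close>.\<close>

lemma cycle_graph_rotate: "cycle_graph (rotate j vs) = cycle_graph vs"
proof (cases "vs = []")
  case False
  let ?n = "length vs"
  have n: "?n > 0" using False by simp
  have nth: "rotate j vs ! i = vs ! ((i + j) mod ?n)" if "i < ?n" for i
    using that by (simp add: nth_rotate add.commute)
  have e: "{rotate j vs ! i, rotate j vs ! (Suc i mod ?n)}
      = {vs ! ((i + j) mod ?n), vs ! (Suc ((i + j) mod ?n) mod ?n)}" if "i < ?n" for i
    using that n by (simp add: nth mod_simps)
  have surj: "\<exists>i<?n. (i + j) mod ?n = l" if "l < ?n" for l
  proof (intro exI conjI)
    \<comment> \<open>The witness is \<open>l - j\<close> modulo \<open>?n\<close>, written so that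
      the subtraction does not truncate.\<close>
    show "(l + (?n - j mod ?n)) mod ?n < ?n" using n by simp
    have "((l + (?n - j mod ?n)) mod ?n + j) mod ?n = (l + (?n - j mod ?n) + j mod ?n) mod ?n"
      by (simp add: mod_simps)
    also have "l + (?n - j mod ?n) + j mod ?n = l + ?n" using mod_le_divisor[OF n, of j] by simp
    finally show "((l + (?n - j mod ?n)) mod ?n + j) mod ?n = l" using that by simp
  qed
  have "{{rotate j vs ! i, rotate j vs ! (Suc i mod ?n)} | i. i < ?n}
      = {{vs ! i, vs ! (Suc i mod ?n)} | i. i < ?n}" (is "?A = ?B")
  proof
    show "?A \<subseteq> ?B" using e n by (auto, metis mod_less_divisor)
    show "?B \<subseteq> ?A" using e surj by (auto, metis)
  qed
  then show ?thesis by (simp add: cycle_graph_def)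
qed simp

text \<open>If two indices gave the same edge, each would be the cyclic successor of the other,
  impossible for length at least 3. Thus the bound on the edges of a cycle bounds its list of
  vertices.\<close>

lemma card_edges_cycle_graph:
  assumes "distinct vs" "length vs \<ge> 3"
  shows "card (edges (cycle_graph vs)) = length vs"
proof -
  let ?n = "length vs"
  let ?e = "\<lambda>i. {vs ! i, vs ! (Suc i mod ?n)}"
  have "inj_on ?e {..<?n}"
  proof (rule inj_onI)
    fix i j assume ij: "i \<in> {..<?n}" "j \<in> {..<?n}" "?e i = ?e j"
    have lt: "Suc i mod ?n < ?n" "Suc j mod ?n < ?n" using assms by (auto intro: mod_less_divisor)
    have "i = j \<or> i = Suc j mod ?n \<and> j = Suc i mod ?n"
      using ij lt assms(1) by (auto simp: doubleton_eq_iff nth_eq_iff_index_eq)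
    then show "i = j" using ij assms(2) by (auto simp: mod_Suc split: if_splits)
  qed
  then have "card (?e ` {..<?n}) = ?n" by (simp add: card_image)
  moreover have "edges (cycle_graph vs) = ?e ` {..<?n}" by (auto simp: cycle_graph_def)
  ultimately show ?thesis by simp
qed

text \<open>Extending the shift by the identity outside \<open>cs\<close> keeps it injective and
  maps every superset of \<open>set cs\<close> into itself, in particular the set of all
  colors.\<close>

lemma cyclic_shift_exists:
  fixes cs :: "'a list"
  assumes "distinct cs"
  obtains p where "inj p" "\<And>B. set cs \<subseteq> B \<Longrightarrow> p ` B \<subseteq> B"
    "\<And>i. i < length cs \<Longrightarrow> p (cs ! i) = cs ! (Suc i mod length cs)"
proof -
  define p where "p b = (case map_of (zip cs (rotate1 cs)) b of None \<Rightarrow> b | Some b' \<Rightarrow> b')" for b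
  have p: "p (cs ! i) = cs ! (Suc i mod length cs)" if "i < length cs" for i
    using that assms by (simp add: p_def map_of_zip_nth nth_rotate1)
  have out: "p b = b" if "b \<notin> set cs" for b
  proof -
    have "map_of (zip cs (rotate1 cs)) b = None" using that by simp
    then show ?thesis by (simp only: p_def option.case)
  qed
  have in_iff: "p b \<in> set cs \<longleftrightarrow> b \<in> set cs" for b
  proof (cases "b \<in> set cs")
    case True
    then obtain i where i: "i < length cs" "b = cs ! i" by (metis in_set_conv_nth)
    then have "Suc i mod length cs < length cs" by (auto intro: mod_less_divisor)
    then show ?thesis using i p True by simp
  qed (simp add: out)
  have "inj p"
  proof (rule injI)
    fix a b assume eq: "p a = p b"
    show "a = b"
    proof (cases "a \<in> set cs")
      case False
      then show ?thesis using eq in_iff out by metis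
    next
      case True
      then have "b \<in> set cs" using eq in_iff by metis
      with True obtain i j where ij: "i < length cs" "a = cs ! i" "j < length cs" "b = cs ! j"
        by (metis in_set_conv_nth)
      then have lt: "Suc i mod length cs < length cs" "Suc j mod length cs < length cs"
        by (auto intro: mod_less_divisor)
      have "Suc i mod length cs = Suc j mod length cs"
        using eq ij p lt assms by (simp add: nth_eq_iff_index_eq)
      then have "i = j" using ij by (auto simp: mod_Suc split: if_splits)
      then show ?thesis using ij by simp
    qed
  qed
  moreover have "p ` B \<subseteq> B" if "set cs \<subseteq> B" for B
    using that in_iff out by (metis image_subsetI subsetD)
  ultimately show ?thesis using p that by blast
qed

lemma funpow_cyclic:
  assumes "\<And>i. i < length cs \<Longrightarrow> p (cs ! i) = cs ! (Suc i mod length cs)" "cs \<noteq> []"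
  shows "(p ^^ j) (cs ! (i mod length cs)) = cs ! ((i + j) mod length cs)"
  using assms by (induction j) (auto simp: mod_Suc_eq)

section \<open>Recovering a cycle from color frequencies\<close>

lemma card_residue_class:
  fixes l m j :: nat
  assumes "j < l"
  shows "card {i. i < m * l \<and> i mod l = j} = m"
proof -
  have "{i. i < m * l \<and> i mod l = j} = (\<lambda>q. q * l + j) ` {..<m}" (is "?A = ?B")
  proof
    show "?A \<subseteq> ?B"
    proof
      fix i assume "i \<in> ?A"
      then have "i = i div l * l + j" "i div l < m"
        using assms by (auto simp: less_mult_imp_div_less)
      then show "i \<in> ?B" by blast
    qed
    show "?B \<subseteq> ?A"
    proof
      fix i assume "i \<in> ?B"
      then obtain q where q: "i = q * l + j" "q < m" by auto
      have "q * l + j < Suc q * l" using assms by simp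
      also have "\<dots> \<le> m * l" using q(2) by (intro mult_le_mono1) simp
      finally show "i \<in> ?A" using q assms by simp
    qed
  qed
  moreover have "inj_on (\<lambda>q. q * l + j) {..<m}" using assms by (auto simp: inj_on_def)
  ultimately show ?thesis by (simp add: card_image)
qed

text \<open>The auxiliary color \<open>a\<close> occurs once less than the genuine colors of the cycle, because \<open>v\<close>
  itself counts as \<open>k\<close>; so maximal frequency tells the colors of the encoded cycle apart from \<open>a\<close>.\<close>

definition major_colors :: "('a \<Rightarrow> nat) \<Rightarrow> nat \<Rightarrow> 'a graph \<Rightarrow> nat set" where
  "major_colors g k Z = {b \<in> g ` verts Z. b = k \<or>
     (\<forall>b'. card {z \<in> verts Z. g z = b'} \<le> card {z \<in> verts Z. g z = b})}"

text \<open>Edges at vertices of the auxiliary color have an endpoint that is not major and are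
  dropped; the two edges at \<open>k\<close> come from the edges at \<open>v\<close>.\<close>

definition decode :: "('a \<Rightarrow> nat) \<Rightarrow> nat \<Rightarrow> 'a graph \<Rightarrow> nat graph" where
  "decode g k Z = (major_colors g k Z, {e \<in> (`) g ` edges Z. e \<subseteq> major_colors g k Z})"

text \<open>The two alternatives for \<open>a\<close> cover both kinds of cycle: either the coloring
  is purely periodic, or position 0 is \<open>v\<close>, marked \<open>k\<close>, and the other
  multiples of the period have the auxiliary color \<open>a\<close>. Every \<open>ds ! j\<close>
  with \<open>j > 0\<close> occurs \<open>m\<close> times.\<close>

lemma decode_cycle_graph:
  fixes g :: "'a \<Rightarrow> nat"
  assumes vs: "distinct vs" "length vs = m * length ds" "m > 0"
    and ds: "distinct ds" "length ds \<ge> 3"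
    and col: "\<And>i. i < length vs \<Longrightarrow>
      g (vs ! i) = (if i mod length ds = 0 \<and> i \<noteq> 0 then a else ds ! (i mod length ds))"
    and a: "a = ds ! 0 \<and> ds ! 0 \<noteq> k \<or> a \<notin> set ds \<and> a \<noteq> k \<and> ds ! 0 = k"
  shows "decode g k (cycle_graph vs) = cycle_graph ds"
proof -
  let ?l = "length ds" and ?n = "length vs"
  define cnt where "cnt b = card {z \<in> set vs. g z = b}" for b
  have l: "?l > 0" using ds by auto
  have n: "?l \<le> ?n" "?n > 0" using vs l by (cases m; simp)+
  have cnt: "cnt b = card {i. i < ?n \<and> g (vs ! i) = b}" for b
  proof -
    have "{z \<in> set vs. g z = b} = (!) vs ` {i. i < ?n \<and> g (vs ! i) = b}"
      by (auto simp: in_set_conv_nth)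
    moreover have "inj_on ((!) vs) {i. i < ?n \<and> g (vs ! i) = b}"
      using vs(1) by (auto simp: inj_on_def nth_eq_iff_index_eq)
    ultimately show ?thesis by (simp add: cnt_def card_image)
  qed
  have cls: "card {i. i < ?n \<and> i mod ?l = j} = m" if "j < ?l" for j
    using card_residue_class[OF that] vs by simp
  have ds_eq: "ds ! i = ds ! j \<longleftrightarrow> i = j" if "i < ?l" "j < ?l" for i j
    using that ds(1) by (simp add: nth_eq_iff_index_eq)
  have a_neq: "a \<noteq> ds ! j" if "0 < j" "j < ?l" for j
    using a ds_eq[OF l that(2)] that by auto
  have cnt_pos: "cnt (ds ! j) = m" if "0 < j" "j < ?l" for j
  proof -
    have "g (vs ! i) = ds ! j \<longleftrightarrow> i mod ?l = j" if "i < ?n" for i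
      using col[OF that] a_neq[of j] ds_eq[of "i mod ?l" j] \<open>0 < j\<close> \<open>j < ?l\<close> l by auto
    then have "{i. i < ?n \<and> g (vs ! i) = ds ! j} = {i. i < ?n \<and> i mod ?l = j}" by auto
    then show ?thesis using cls that by (simp add: cnt)
  qed
  \<comment> \<open>In the second case index 0 is taken by \<open>k\<close>, so at most
    \<open>m - 1\<close> positions remain for \<open>a\<close>.\<close>
  have zero: "cnt (ds ! 0) = m \<and> ds ! 0 \<noteq> k \<or> ds ! 0 = k \<and> a \<notin> set ds \<and> a \<noteq> k \<and> cnt a < m \<and> cnt k \<le> 1"
  proof (cases "a = ds ! 0")
    case True
    have "g (vs ! i) = ds ! 0 \<longleftrightarrow> i mod ?l = 0" if "i < ?n" for i
      using col[OF that] True ds_eq[of "i mod ?l" 0] l by auto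
    then have "{i. i < ?n \<and> g (vs ! i) = ds ! 0} = {i. i < ?n \<and> i mod ?l = 0}" by auto
    then have "cnt (ds ! 0) = m" using cls l by (simp add: cnt)
    then show ?thesis using a True l by auto
  next
    case False
    then have a': "a \<notin> set ds" "a \<noteq> k" "ds ! 0 = k" using a by auto
    have in_ds: "ds ! (i mod ?l) \<in> set ds" for i using l by (intro nth_mem) simp
    then have "i mod ?l = 0 \<and> i \<noteq> 0" if "i < ?n" "g (vs ! i) = a" for i
      using col[OF that(1)] that(2) a'(1) by (metis (full_types))
    then have "{i. i < ?n \<and> g (vs ! i) = a} \<subseteq> {i. i < ?n \<and> i mod ?l = 0} - {0}" by auto
    then have "cnt a \<le> card ({i. i < ?n \<and> i mod ?l = 0} - {0})" unfolding cnt by (intro card_mono) auto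
    also have "\<dots> = m - 1" using cls[of 0] l n by (simp add: card_Diff_singleton)
    finally have "cnt a < m" using vs by simp
    moreover have "i = 0" if "i < ?n" "g (vs ! i) = k" for i
    proof (rule ccontr)
      assume "i \<noteq> 0"
      then have "i mod ?l \<noteq> 0" "ds ! (i mod ?l) = ds ! 0"
        using col[OF that(1)] that(2) a'(2,3) by metis+
      then show False using ds_eq[of "i mod ?l" 0] l by simp
    qed
    then have "{i. i < ?n \<and> g (vs ! i) = k} \<subseteq> {0}" by auto
    then have "cnt k \<le> card {0::nat}" unfolding cnt by (intro card_mono) auto
    ultimately show ?thesis using a' by simp
  qed
  have img: "g ` set vs \<subseteq> insert a (set ds)"
  proof
    fix b assume "b \<in> g ` set vs"
    then obtain i where i: "i < ?n" "b = g (vs ! i)" by (auto simp: in_set_conv_nth)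
    have "ds ! (i mod ?l) \<in> set ds" using l by (intro nth_mem) simp
    then show "b \<in> insert a (set ds)" using col[OF i(1)] i(2) by simp
  qed
  have sub: "set ds \<subseteq> g ` set vs"
  proof
    fix b assume "b \<in> set ds"
    then obtain j where j: "j < ?l" "b = ds ! j" by (metis in_set_conv_nth)
    then have "g (vs ! j) = b" "j < ?n" using col[of j] n by auto
    then show "b \<in> g ` set vs" by (metis image_eqI nth_mem)
  qed
  have cnt_out: "cnt b = 0" if "b \<notin> g ` set vs" for b
    using that by (auto simp: cnt_def)
  have cnt_le: "cnt b \<le> m" for b
  proof (cases "b \<in> g ` set vs")
    case True
    then consider "b = a" "a \<notin> set ds" | j where "j < ?l" "b = ds ! j"
      using img by (metis in_mono in_set_conv_nth insertE)
    then show ?thesis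
    proof cases
      case 1
      then show ?thesis using zero a l by auto
    next
      case 2
      then show ?thesis using zero cnt_pos[of j] vs(3) by (cases "j = 0") auto
    qed
  qed (simp add: cnt_out)
  \<comment> \<open>The bound \<open>m\<close> is attained, so maximal frequency means frequency
    exactly \<open>m\<close>.\<close>
  have ds1: "cnt (ds ! 1) = m" using cnt_pos[of 1] ds by simp
  have V: "major_colors g k (cycle_graph vs) = set ds"
  proof -
    have "major_colors g k (cycle_graph vs) = {b \<in> g ` set vs. b = k \<or> (\<forall>b'. cnt b' \<le> cnt b)}"
      by (simp add: major_colors_def cycle_graph_def cnt_def)
    also have "\<dots> = {b \<in> g ` set vs. b = k \<or> cnt b = m}"
      using cnt_le ds1 by (metis (lifting) antisym)
    also have "\<dots> = set ds"
    proof
      show "{b \<in> g ` set vs. b = k \<or> cnt b = m} \<subseteq> set ds"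
      proof
        fix b assume b: "b \<in> {b \<in> g ` set vs. b = k \<or> cnt b = m}"
        have "ds ! 0 \<in> set ds" using l by simp
        moreover have "b \<in> insert a (set ds)" using b img by blast
        moreover have "b = k \<or> cnt b = m" using b by simp
        ultimately show "b \<in> set ds" using zero a by auto
      qed
      show "set ds \<subseteq> {b \<in> g ` set vs. b = k \<or> cnt b = m}"
      proof
        fix b assume b: "b \<in> set ds"
        then obtain j where j: "j < ?l" "b = ds ! j" by (metis in_set_conv_nth)
        then have "b = k \<or> cnt b = m" using zero cnt_pos[of j] by (cases "j = 0") auto
        then show "b \<in> {b \<in> g ` set vs. b = k \<or> cnt b = m}" using b sub by auto
      qed
    qed
    finally show ?thesis .
  qed
  have g_in: "g (vs ! i) = ds ! (i mod ?l)" if "i < ?n" "g (vs ! i) \<in> set ds" for i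
    using col[OF that(1)] that(2) a by (auto split: if_splits)
  \<comment> \<open>As \<open>?l\<close> divides \<open>?n\<close>, closing up \<open>vs\<close>
    agrees with closing up \<open>ds\<close>.\<close>
  have mod_mod: "Suc i mod ?n mod ?l = Suc (i mod ?l) mod ?l" for i
    using vs(2) by (simp add: mod_mod_cancel mod_simps)
  let ?e = "\<lambda>i. {ds ! i, ds ! (Suc i mod ?l)}"
  have "{e \<in> (`) g ` edges (cycle_graph vs). e \<subseteq> set ds} = edges (cycle_graph ds)" (is "?A = ?B")
  proof
    show "?A \<subseteq> ?B"
    proof
      fix e assume "e \<in> ?A"
      then obtain i where i: "i < ?n" "e = {g (vs ! i), g (vs ! (Suc i mod ?n))}" "e \<subseteq> set ds"
        by (auto simp: cycle_graph_def)
      have "Suc i mod ?n < ?n" using n by simp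
      then have "e = ?e (i mod ?l)"
        using i g_in[of i] g_in[of "Suc i mod ?n"] by (simp add: mod_mod)
      then show "e \<in> ?B" using l by (auto simp: cycle_graph_def intro!: exI[of _ "i mod ?l"])
    qed
    show "?B \<subseteq> ?A"
    proof
      fix e assume "e \<in> ?B"
      then obtain j where j: "j < ?l" "e = ?e j" by (auto simp: cycle_graph_def)
      have in_ds: "e \<subseteq> set ds" using j l by auto
      \<comment> \<open>The first pass through \<open>ds\<close> shows all edges but the closing
        one. That one is read off where \<open>vs\<close> closes, since among the multiples of
        \<open>?l\<close> only index 0 is certain to have color \<open>ds ! 0\<close>.\<close>
      have "\<exists>i<?n. g (vs ! i) = ds ! j \<and> g (vs ! (Suc i mod ?n)) = ds ! (Suc j mod ?l)"
      proof (cases "Suc j < ?l")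
        case True
        then show ?thesis using col[of j] col[of "Suc j"] n by (intro exI[of _ j]) auto
      next
        case False
        then have j': "Suc j = ?l" using j by simp
        have "(?n - 1) mod ?l = j"
        proof -
          have "?n - 1 = j + (m - 1) * ?l" using vs(2,3) j' by (cases m) auto
          then show ?thesis using j by simp
        qed
        moreover have "j > 0" using j' ds by simp
        ultimately have "g (vs ! (?n - 1)) = ds ! j" using col[of "?n - 1"] n by simp
        moreover have "g (vs ! 0) = ds ! 0" using col[of 0] n by simp
        ultimately show ?thesis using n j' by (intro exI[of _ "?n - 1"]) simp
      qed
      then obtain i where i: "i < ?n" "g ` {vs ! i, vs ! (Suc i mod ?n)} = e" using j by auto
      then have "e \<in> (`) g ` edges (cycle_graph vs)"
        unfolding cycle_graph_def by (simp only: snd_conv) blast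
      then show "e \<in> ?A" using in_ds by simp
    qed
  qed
  then show ?thesis using V by (simp add: decode_def cycle_graph_def)
qed

section \<open>Deleting a vertex of minimum degree from a critical graph\<close>

lemma colorable_chromatic_number:
  assumes "simple_graph H"
  shows "\<exists>c. proper_coloring H (chromatic_number H) c"
proof -
  obtain c :: "'a \<Rightarrow> nat" and n where "c ` verts H = {i. i < n}" "inj_on c (verts H)"
    using assms finite_imp_nat_seg_image_inj_on[of "verts H"]
      finite_imp_inj_to_nat_seg[of "verts H"] by (auto simp: simple_graph_def)
  moreover have "u \<noteq> w \<and> u \<in> verts H \<and> w \<in> verts H" if "{u, w} \<in> edges H" for u w
    using that assms by (auto simp: simple_graph_def)
  ultimately have "proper_coloring H n c"
    unfolding proper_coloring_def by (auto simp: inj_on_eq_iff)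
  then show ?thesis
    using LeastI[of "\<lambda>n. \<exists>c. proper_coloring H n c" n] unfolding chromatic_number_def by blast
qed

definition delete_vertex :: "'a graph \<Rightarrow> 'a \<Rightarrow> 'a graph" where
  "delete_vertex G v = (verts G - {v}, {e \<in> edges G. v \<notin> e})"

lemma simple_delete_vertex: "simple_graph G \<Longrightarrow> simple_graph (delete_vertex G v)"
  by (auto simp: simple_graph_def delete_vertex_def)

lemma cycles_delete_vertex: "cycles (delete_vertex G v) \<subseteq> cycles G"
  by (auto simp: cycles_def subgraph_def delete_vertex_def)

text \<open>A color missing among the neighbors of \<open>v\<close> could be given to
  \<open>v\<close>, making \<open>G\<close> \<open>k\<close>-colorable. So all \<open>k\<close>
  colors occur on the \<open>k\<close> neighbors, each exactly once.\<close>

lemma critical_min_degree_vertex: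
  assumes crit: "critical (k + 1) G" and deg: "min_degree G = k"
  obtains v c where "proper_coloring (delete_vertex G v) k c"
    "\<And>d. proper_coloring (delete_vertex G v) k d \<Longrightarrow>
      bij_betw d {u \<in> verts G. {v, u} \<in> edges G} {..<k}"
proof -
  have G: "simple_graph G" and chi: "chromatic_number G = k + 1"
    and sub: "\<And>H. proper_subgraph H G \<Longrightarrow> chromatic_number H < k + 1"
    using crit by (auto simp: critical_def)
  have not_colorable: "\<not> proper_coloring G n c" if "n \<le> k" for n c
    using Least_le[of "\<lambda>n. \<exists>c. proper_coloring G n c" n] chi that
    by (auto simp: chromatic_number_def)
  \<comment> \<open>An empty graph has a coloring with 0 colors. Nonemptiness makes the
    \<open>Min\<close> in \<open>min_degree\<close> an attained value.\<close>
  have "verts G \<noteq> {}"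
  proof
    assume "verts G = {}"
    then have "proper_coloring G 0 undefined"
      using G by (fastforce simp: proper_coloring_def simple_graph_def)
    then show False using not_colorable by blast
  qed
  moreover have "finite (verts G)" using G by (simp add: simple_graph_def)
  ultimately have "min_degree G \<in> degree G ` verts G" unfolding min_degree_def by (intro Min_in) auto
  then obtain v where v: "v \<in> verts G" "degree G v = k" using deg by auto
  let ?N = "{u \<in> verts G. {v, u} \<in> edges G}" and ?H = "delete_vertex G v"
  have "verts ?H \<noteq> verts G" "verts ?H \<subseteq> verts G" "edges ?H \<subseteq> edges G"
    using v(1) by (auto simp: delete_vertex_def)
  then have "proper_subgraph ?H G" using simple_delete_vertex[OF G, of v]
    by (auto simp: proper_subgraph_def subgraph_def)
  then have "chromatic_number ?H \<le> k" using sub[of ?H] by simp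
  moreover obtain c where "proper_coloring ?H (chromatic_number ?H) c"
    using colorable_chromatic_number[OF simple_delete_vertex[OF G]] by blast
  ultimately have "proper_coloring ?H k c" by (auto simp: proper_coloring_def)
  moreover have "bij_betw d ?N {..<k}" if d: "proper_coloring ?H k d" for d
  proof -
    have N: "?N \<subseteq> verts ?H" using G by (auto simp: simple_graph_def delete_vertex_def)
    have surj: "\<exists>u\<in>?N. d u = b" if b: "b < k" for b
    proof (rule ccontr)
      assume no: "\<not> (\<exists>u\<in>?N. d u = b)"
      have "proper_coloring G k (d(v := b))"
        unfolding proper_coloring_def
      proof (intro conjI allI impI ballI)
        fix u assume "u \<in> verts G"
        then show "(d(v := b)) u < k" using d b by (auto simp: proper_coloring_def delete_vertex_def)
      next
        fix u w assume e: "{u, w} \<in> edges G"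
        then have "u \<in> verts G" "w \<in> verts G" "u \<noteq> w" "{w, u} \<in> edges G"
          using G by (auto simp: simple_graph_def insert_commute)
        moreover have "d u \<noteq> d w" if "u \<noteq> v" "w \<noteq> v"
          using that e d by (auto simp: proper_coloring_def delete_vertex_def)
        ultimately show "(d(v := b)) u \<noteq> (d(v := b)) w" using no e by auto
      qed
      then show False using not_colorable by blast
    qed
    have "d ` ?N = {..<k}"
    proof
      show "d ` ?N \<subseteq> {..<k}" using d N by (auto simp: proper_coloring_def)
      show "{..<k} \<subseteq> d ` ?N" using surj by blast
    qed
    moreover have "card ?N = k" using v(2) by (simp add: degree_def)
    ultimately show ?thesis
      using \<open>finite (verts G)\<close> by (auto simp: bij_betw_def intro!: eq_card_imp_inj_on)
  qed
  ultimately show ?thesis using that by blast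
qed

section \<open>Cycles of \<open>G\<close> with periodic colors\<close>

text \<open>Each step advances the color by one place in \<open>cs\<close>; returning to the initial
  color forces the period to divide the length.\<close>

lemma periodic_cycle:
  assumes G: "simple_graph G" and cs: "distinct cs" "length cs \<ge> 3"
    and p: "\<And>i. i < length cs \<Longrightarrow> p (cs ! i) = cs ! (Suc i mod length cs)"
    and walk: "(x, x) \<in> {(u, w). {u, w} \<in> edges G \<and> d w = p (d u)}\<^sup>+"
    and x: "d x = cs ! 0"
  obtains vs m where "distinct vs" "length vs = m * length cs" "m > 0" "vs ! 0 = x"
    "cycle_graph vs \<in> cycles G"
    "\<And>i. i < length vs \<Longrightarrow> d (vs ! i) = cs ! (i mod length cs)"
proof -
  let ?l = "length cs"
  obtain vs where vs: "distinct vs" "vs \<noteq> []" "vs ! 0 = x"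
    and step: "\<And>i. i < length vs \<Longrightarrow>
      {vs ! i, vs ! (Suc i mod length vs)} \<in> edges G \<and> d (vs ! (Suc i mod length vs)) = p (d (vs ! i))"
    using directed_cycle_through[OF walk] by (metis (mono_tags, lifting) case_prodD mem_Collect_eq)
  let ?n = "length vs"
  have n: "?n > 0" using vs by simp
  have l: "?l > 0" using cs by linarith
  have col: "d (vs ! i) = cs ! (i mod ?l)" if "i < ?n" for i
    using that
  proof (induction i)
    case 0
    then show ?case using vs x by simp
  next
    case (Suc i)
    then show ?case using step[of i] p[of "i mod ?l"] l by (simp add: mod_simps)
  qed
  have "cs ! 0 = p (cs ! ((?n - 1) mod ?l))"
    using step[of "?n - 1"] col[of "?n - 1"] n vs x by simp
  also have "\<dots> = cs ! (?n mod ?l)" using p[of "(?n - 1) mod ?l"] l n by (simp add: mod_simps)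
  finally have "?n mod ?l = 0" using cs(1) l
    by (metis mod_less_divisor nth_eq_iff_index_eq)
  then obtain m where m: "?n = m * ?l" by (metis dvd_def mod_0_imp_dvd mult.commute)
  then have "m > 0" using n by (cases m) auto
  \<comment> \<open>A positive multiple of a period at least 3: this excludes degenerate closed
    walks.\<close>
  then have "?n \<ge> 3" using m cs(2) by (cases m) auto
  moreover have "subgraph (cycle_graph vs) G"
  proof -
    have "e \<in> edges G" if "e \<in> edges (cycle_graph vs)" for e
      using that step by (auto simp: cycle_graph_def)
    moreover have "v \<in> verts G" if "v \<in> set vs" for v
    proof -
      obtain i where i: "i < ?n" "v = vs ! i" using \<open>v \<in> set vs\<close> by (metis in_set_conv_nth)
      then have "{v, vs ! (Suc i mod ?n)} \<subseteq> verts G"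
        using step[OF i(1)] G unfolding simple_graph_def by blast
      then show ?thesis by simp
    qed
    moreover have "e \<subseteq> set vs" if "e \<in> edges (cycle_graph vs)" for e
      using that n by (auto simp: cycle_graph_def)
    moreover have "verts (cycle_graph vs) = set vs" by (simp add: cycle_graph_def)
    ultimately have "verts (cycle_graph vs) \<subseteq> verts G" "edges (cycle_graph vs) \<subseteq> edges G"
      "\<forall>e\<in>edges (cycle_graph vs). e \<subseteq> verts (cycle_graph vs)" "finite (verts (cycle_graph vs))"
      by (simp_all add: subset_iff)
    then show ?thesis using G unfolding subgraph_def simple_graph_def by blast
  qed
  moreover have "is_cycle (cycle_graph vs)" if "?n \<ge> 3"
    unfolding is_cycle_iff using vs(1) that by blast
  ultimately have "cycle_graph vs \<in> cycles G" unfolding cycles_def by blast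
  then show ?thesis by (rule that[OF vs(1) m \<open>m > 0\<close> vs(3) _ col])
qed

lemma cycle_with_decoding:
  assumes G: "simple_graph G" and c: "proper_coloring (delete_vertex G v) k c"
    and bij: "\<And>d. proper_coloring (delete_vertex G v) k d \<Longrightarrow>
      bij_betw d {u \<in> verts G. {v, u} \<in> edges G} {..<k}"
    and C: "C \<in> cycles_le k (complete_graph (k + 1))"
  shows "\<exists>Z \<in> cycles G. decode (c(v := k)) k Z = C \<and> [card (verts Z) = 0] (mod card (verts C))"
proof -
  let ?N = "{u \<in> verts G. {v, u} \<in> edges G}" and ?H = "delete_vertex G v"
  \<comment> \<open>All colors of \<open>c\<close> on \<open>G - v\<close> are below
    \<open>k\<close>, so within \<open>G\<close> the value \<open>k\<close> marks \<open>v\<close>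
    alone.\<close>
  let ?g = "c(v := k)"
  have H: "simple_graph ?H" using G by (rule simple_delete_vertex)
  have N: "?N \<subseteq> verts ?H" using G by (auto simp: simple_graph_def delete_vertex_def)
  have nbr: "\<exists>u\<in>?N. c u = b" if "b < k" for b
  proof -
    have "b \<in> c ` ?N" using bij_betw_imp_surj_on[OF bij[OF c]] that by simp
    then show ?thesis by blast
  qed
  obtain ds0 where ds0: "distinct ds0" "length ds0 \<ge> 3" "C = cycle_graph ds0"
    using C by (auto simp: cycles_le_def cycles_def is_cycle_iff)
  have len: "length ds0 \<le> k" and ds0_sub: "set ds0 \<subseteq> {..<k + 1}"
    using C ds0 card_edges_cycle_graph[OF ds0(1,2)]
    by (auto simp: cycles_le_def cycles_def subgraph_def complete_graph_def cycle_graph_def)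
  have finish: ?thesis
    if "distinct vs" "length vs = m * length ds" "cycle_graph vs \<in> cycles G"
      "decode ?g k (cycle_graph vs) = cycle_graph ds" "C = cycle_graph ds" "distinct ds" for vs ds m
    using that by (intro bexI[of _ "cycle_graph vs"])
      (auto simp: cycle_graph_def distinct_card cong_0_iff)
  show ?thesis
  proof (cases "k \<in> set ds0")
    case False
    then have sub: "set ds0 \<subseteq> {..<k}" using ds0_sub by (auto simp: less_Suc_eq)
    obtain p where p: "inj p" "\<And>B. set ds0 \<subseteq> B \<Longrightarrow> p ` B \<subseteq> B"
      "\<And>i. i < length ds0 \<Longrightarrow> p (ds0 ! i) = ds0 ! (Suc i mod length ds0)"
      using cyclic_shift_exists[OF ds0(1)] by blast
    let ?D = "{(u, w). {u, w} \<in> edges ?H \<and> c w = p (c u)}"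
    note reach = reachable_iterate[OF H c inj_on_subset[OF p(1) subset_UNIV] p(2)[OF sub] N bij]
    have lt: "0 < length ds0" "1 < length ds0" using ds0(2) by linarith+
    then have "ds0 ! 0 < k" "ds0 ! 1 < k" using sub by (meson lessThan_iff nth_mem subsetD)+
    obtain x where x: "x \<in> ?N" "c x = ds0 ! 0" using nbr[OF \<open>ds0 ! 0 < k\<close>] by blast
    \<comment> \<open>A second neighbor, different from \<open>x\<close>, makes the walk from
      \<open>x\<close> back to \<open>x\<close> nonempty.\<close>
    obtain y where y: "y \<in> ?N" "c y = ds0 ! 1" using nbr[OF \<open>ds0 ! 1 < k\<close>] by blast
    have "ds0 ! 0 \<noteq> ds0 ! 1" using ds0(1) lt by (simp add: nth_eq_iff_index_eq)
    then have "x \<noteq> y" using x y by auto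
    have "c y = (p ^^ 1) (c x)" using x y p(3)[of 0] lt by simp
    then have "(x, y) \<in> ?D\<^sup>*" using reach x(1) y(1) by blast
    then have "(x, y) \<in> ?D\<^sup>+" using \<open>x \<noteq> y\<close> by (meson rtranclD)
    also have "c x = (p ^^ (length ds0 - 1)) (c y)"
      using funpow_cyclic[of ds0 p "length ds0 - 1" 1] p(3) lt x y by force
    then have "(y, x) \<in> ?D\<^sup>*" using reach x(1) y(1) by blast
    finally (trancl_rtrancl_trancl) have "(x, x) \<in> ?D\<^sup>+" .
    from periodic_cycle[where d = c, OF H ds0(1,2) p(3) this x(2)] obtain vs m where
      vs: "distinct vs" "length vs = m * length ds0" "m > 0"
      "cycle_graph vs \<in> cycles ?H"
      and col: "\<And>i. i < length vs \<Longrightarrow> c (vs ! i) = ds0 ! (i mod length ds0)" by metis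
    \<comment> \<open>The cycle lies in \<open>G - v\<close>, where \<open>?g\<close> agrees with
      \<open>c\<close>; \<open>ds0 ! 0\<close> serves as \<open>a\<close> in the decoding.\<close>
    have "v \<notin> set vs" using vs(4)
      by (auto simp: cycles_def subgraph_def delete_vertex_def cycle_graph_def)
    then have "?g (vs ! i) = (if i mod length ds0 = 0 \<and> i \<noteq> 0 then ds0 ! 0 else ds0 ! (i mod length ds0))"
      if "i < length vs" for i
      using col[OF that] nth_mem[OF that] by auto
    then have "decode ?g k (cycle_graph vs) = cycle_graph ds0"
    proof (rule decode_cycle_graph[OF vs(1-3) ds0(1,2)])
      show "ds0 ! 0 = ds0 ! 0 \<and> ds0 ! 0 \<noteq> k \<or> ds0 ! 0 \<notin> set ds0 \<and> ds0 ! 0 \<noteq> k \<and> ds0 ! 0 = k"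
        using \<open>ds0 ! 0 < k\<close> by simp
    qed
    moreover have "cycle_graph vs \<in> cycles G" using vs(4) cycles_delete_vertex by (rule subsetD[rotated])
    ultimately show ?thesis using finish[OF vs(1,2) _ _ ds0(3,1)] by simp
  next
    case True
    then obtain j where j: "j < length ds0" "ds0 ! j = k" by (metis in_set_conv_nth)
    define ds where "ds = rotate j ds0"
    have ds: "distinct ds" "length ds \<ge> 3" "C = cycle_graph ds" "set ds = set ds0" "length ds \<le> k"
      using ds0 len by (simp_all add: ds_def cycle_graph_rotate)
    have "ds ! 0 = k" using j nth_rotate[of 0 ds0 j] by (cases ds0) (auto simp: ds_def)
    then obtain es where es: "ds = k # es" using ds(2) by (cases ds) auto
    have es_sub: "set es \<subseteq> {..<k}" using ds0_sub ds(1,4) es by (auto simp: less_Suc_eq)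
    \<comment> \<open>Here the length bound enters: besides \<open>k\<close> itself,
      \<open>C\<close> uses at most \<open>k - 1\<close> colors, so one is free.\<close>
    have "card (set es) < k" using ds(1,5) es by (simp add: distinct_card)
    then obtain a where a: "a < k" "a \<notin> set es"
      by (metis card_lessThan card_mono finite_set leD lessThan_iff subsetI)
    \<comment> \<open>\<open>?d\<close> lets \<open>v\<close> play the role of \<open>k\<close>
      under the name \<open>a\<close>. It is not a proper coloring, as some neighbor of
      \<open>v\<close> already has color \<open>a\<close>.\<close>
    let ?cs = "a # es" and ?d = "c(v := a)"
    have cs: "distinct ?cs" "length ?cs = length ds" "length ?cs \<ge> 3" using ds a es by auto
    have cs_sub: "set ?cs \<subseteq> {..<k}" using es_sub a by simp
    obtain p where p: "inj p" "\<And>B. set ?cs \<subseteq> B \<Longrightarrow> p ` B \<subseteq> B"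
      "\<And>i. i < length ?cs \<Longrightarrow> p (?cs ! i) = ?cs ! (Suc i mod length ?cs)"
      using cyclic_shift_exists[OF cs(1)] by blast
    let ?D = "{(u, w). {u, w} \<in> edges ?H \<and> c w = p (c u)}"
    let ?D' = "{(u, w). {u, w} \<in> edges G \<and> ?d w = p (?d u)}"
    note reach = reachable_iterate[OF H c inj_on_subset[OF p(1) subset_UNIV] p(2)[OF cs_sub] N bij]
    let ?l = "length ?cs"
    have lt: "1 < ?l" "?l - 1 < ?l" using cs(3) by linarith+
    have cs_lt: "?cs ! i < k" if "i < ?l" for i using cs_sub nth_mem[OF that] by blast
    obtain x where x: "x \<in> ?N" "c x = ?cs ! 1" using nbr[OF cs_lt[OF lt(1)]] by blast
    obtain y where y: "y \<in> ?N" "c y = ?cs ! (?l - 1)" using nbr[OF cs_lt[OF lt(2)]] by blast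
    have neq: "x \<noteq> v" "y \<noteq> v" using x(1) y(1) N by (auto simp: delete_vertex_def)
    \<comment> \<open>The path inside \<open>G - v\<close> runs from the color after
      \<open>a\<close> to the color before \<open>a\<close>, which takes \<open>?l - 2\<close>
      shifts.\<close>
    have "c y = (p ^^ (?l - 2)) (c x)"
    proof -
      have "(p ^^ (?l - 2)) (?cs ! (1 mod ?l)) = ?cs ! ((1 + (?l - 2)) mod ?l)"
        by (rule funpow_cyclic[OF p(3)]) auto
      moreover have "1 + (?l - 2) = ?l - 1" "1 mod ?l = 1" using cs(3) by (auto simp del: list.size)
      ultimately show ?thesis using x y lt by (metis mod_less)
    qed
    then have "(x, y) \<in> ?D\<^sup>*" using reach x(1) y(1) by blast
    moreover have "?D \<subseteq> ?D'" by (auto simp: delete_vertex_def)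
    ultimately have "(x, y) \<in> ?D'\<^sup>*" using rtrancl_mono by blast
    \<comment> \<open>The two remaining shifts, out of \<open>a\<close> and back into it, are the
      edges at \<open>v\<close>.\<close>
    moreover have "(v, x) \<in> ?D'" using x neq p(3)[of 0] lt by simp
    moreover have "(y, v) \<in> ?D'"
      using y neq p(3)[of "?l - 1"] lt by (simp add: insert_commute)
    ultimately have walk: "(v, v) \<in> ?D'\<^sup>+" by (meson rtrancl_into_trancl1 rtrancl_into_trancl2 trancl_into_rtrancl)
    have "?d v = ?cs ! 0" by simp
    from periodic_cycle[where d = ?d, OF G cs(1,3) p(3) walk this] obtain vs m where
      vs: "distinct vs" "length vs = m * ?l" "m > 0" "vs ! 0 = v" "cycle_graph vs \<in> cycles G"
      and col: "\<And>i. i < length vs \<Longrightarrow> ?d (vs ! i) = ?cs ! (i mod ?l)" by metis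
    have vs_len: "length vs = m * length ds" using vs(2) unfolding cs(2) .
    then have "0 < length vs" using vs(3) ds(2) by (cases m) auto
    \<comment> \<open>\<open>?g\<close> and \<open>?d\<close> differ only at \<open>v\<close>, which
      is \<open>vs ! 0\<close> and occurs nowhere else in \<open>vs\<close>.\<close>
    have "?g (vs ! i) = (if i mod length ds = 0 \<and> i \<noteq> 0 then a else ds ! (i mod length ds))"
      if i: "i < length vs" for i
    proof (cases "i = 0")
      case True
      then show ?thesis using vs(4) es by simp
    next
      case False
      then have "vs ! i \<noteq> v"
        using vs(1,4) i \<open>0 < length vs\<close> nth_eq_iff_index_eq[of vs i 0] by simp
      then have "?g (vs ! i) = ?cs ! (i mod length ds)" using col[OF i] cs(2) by simp
      then show ?thesis using False es by (cases "i mod length ds") auto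
    qed
    then have "decode ?g k (cycle_graph vs) = cycle_graph ds"
      by (rule decode_cycle_graph[OF vs(1) vs_len vs(3) ds(1,2)]) (use ds(1) es a in auto)
    then show ?thesis by (rule finish[OF vs(1) vs_len vs(5) _ ds(3,1)])
  qed
qed

theorem theorem5:
  fixes k :: nat and G :: "'a graph"
  assumes "k \<ge> 3"
    and "critical (k + 1) G"
    and "min_degree G = k"
  shows "\<exists>f :: nat graph \<Rightarrow> 'a graph.
    inj_on f (cycles_le k (complete_graph (k + 1))) \<and>
    f ` cycles_le k (complete_graph (k + 1)) \<subseteq> cycles G \<and>
    (\<forall>C \<in> cycles_le k (complete_graph (k + 1)).
       [card (verts (f C)) = 0] (mod card (verts C)))"
proof -
  obtain v c where v: "proper_coloring (delete_vertex G v) k c"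
    "\<And>d. proper_coloring (delete_vertex G v) k d \<Longrightarrow>
      bij_betw d {u \<in> verts G. {v, u} \<in> edges G} {..<k}"
    using critical_min_degree_vertex[OF assms(2,3)] by blast
  have "simple_graph G" using assms(2) by (simp add: critical_def)
  then have "\<forall>C \<in> cycles_le k (complete_graph (k + 1)). \<exists>Z. Z \<in> cycles G \<and>
      decode (c(v := k)) k Z = C \<and> [card (verts Z) = 0] (mod card (verts C))"
    using cycle_with_decoding[OF _ v] by blast
  then obtain f where f: "\<forall>C \<in> cycles_le k (complete_graph (k + 1)). f C \<in> cycles G \<and>
      decode (c(v := k)) k (f C) = C \<and> [card (verts (f C)) = 0] (mod card (verts C))"
    by (elim bchoice[THEN exE])
  \<comment> \<open>One fixed decoding is a left inverse of \<open>f\<close>, whichever cycles were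
    chosen.\<close>
  then have "inj_on f (cycles_le k (complete_graph (k + 1)))"
    by (metis inj_on_inverseI)
  then show ?thesis using f by (intro exI[of _ f]) auto
qed

end
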